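(* Let $L$ be an $\mathbb{A}$-field and $\phi$ a rank $r$ Drinfeld module over $L$ with $\phi_T=T+\sum_{i=1}^rA_i\tau^i$. For $m\in\mathbb{N}$ define $c(n;m)\in L$ by $\phi_{T^m}=\sum_{n=0}^{rm}c(n;m)\tau^n$, and $c(n;m)=0$ for $n<0$ or $n>rm$. Then for all $m,n\ge0$, \[c(n;m)=\sum_{\mathbf{S}\in P_r(n)}\mathbf{A}^{\mathbf{S}}\cdot h^{(\bigcup\mathbf{S}\,\cup\,\{n\})}_{m-|\mathbf{S}|}.\]
   Context: $q$ is a prime power, $\mathbb{A}=\mathbb{F}_q[T]$. An $\mathbb{A}$-field is a field $L$ with a nonzero ring homomorphism $\iota:\mathbb{A}\to L$; we write $a$ for $\iota(a)$. $\tau$ is the $q$-Frobenius and $L\{\tau\}$ the twisted polynomial ring with $\tau\ell=\ell^q\tau$. A rank $r$ Drinfeld module over $L$ is an $\mathbb{F}_q$-linear ring homomorphism $\phi:\mathbb{A}\to L\{\tau\}$ with $\phi_T=T+\sum_{i=1}^rA_i\tau^i$, $A_r\ne0$. For finite $S\subset\mathbb{N}$, $w(S)=\sum_{i\in S}q^i$. For $n\in\mathbb{Z}$ and finite $S\subset\mathbb{N}$, $I_n(S)$ is the set of families $(k_i)_{i\in S}$ with $k_i\in\mathbb{N}$ and $\sum_{i\in S}k_i=n$ (so $I_n(S)=\emptyset$ for $n<0$, $I_0(\emptyset)=\{\emptyset\}$, $I_n(\emptyset)=\emptyset$ for $n\ne0$), and $h^S_n:=\sum_{(k_i)\in I_n(S)}T^{\sum_{i\in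 S}k_iq^i}$. Shadowed partitions: for $n>0$, $P_r(n)$ is the set of $r$-tuples $\mathbf{S}=(S_1,\dots,S_r)$ of subsets of $\{0,\dots,n-1\}$ such that the sets $S_i+j:=\{s+j:s\in S_i\}$ ($1\le i\le r$, $0\le j\le i-1$) form a partition of $\{0,\dots,n-1\}$; $P_r(0)$ consists only of the tuple of empty sets. For $\mathbf{S}\in P_r(n)$: $|\mathbf{S}|=\sum_i|S_i|$, $\bigcup\mathbf{S}=\bigcup_iS_i$, $\mathbf{A}^{\mathbf{S}}=\prod_iA_i^{w(S_i)}$. *)

theory Defs
  imports
    "HOL-Algebra.Algebraic_Closure_Type"
    "HOL-Algebra.Sylow"
    "HOL-Library.Cardinality"
    "HOL-Library.FuncSet"
    "HOL-Library.Disjoint_Sets"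
    "HOL-Computational_Algebra.Computational_Algebra"
begin

section \<open>Twisted polynomials\<close>

text \<open>
  The twisted polynomial \<open>\<Sum>i. a\<^sub>i \<tau>\<^sup>i\<close> is represented by the ordinary polynomial type, with
  \<open>coeff f i = a\<^sub>i\<close>; in particular \<open>a \<tau>\<^sup>i\<close> is \<open>monom a i\<close> and \<open>\<tau>\<close> is \<open>monom 1 1\<close>.  The rule
  \<open>\<tau> a = a\<^sup>q \<tau>\<close> gives \<open>(a \<tau>\<^sup>i) (b \<tau>\<^sup>j) = a b\<^bsup>q\<^sup>i\<^esup> \<tau>\<^bsup>i + j\<^esup>\<close>, which is extended bilinearly.
\<close>

definition twisted_mult :: "nat \<Rightarrow> 'l::field poly \<Rightarrow> 'l poly \<Rightarrow> 'l poly" where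
  "twisted_mult q f g =
     (\<Sum>i\<le>degree f. \<Sum>j\<le>degree g. monom (coeff f i * coeff g j ^ (q ^ i)) (i + j))"

definition twisted_poly_ring :: "nat \<Rightarrow> 'l::field poly ring" where
  "twisted_poly_ring q =
     \<lparr>carrier = UNIV, monoid.mult = twisted_mult q, one = 1, zero = 0, add = (+)\<rparr>"

lemma twisted_mult_coeff:
  assumes "q > 0"
  shows "coeff (twisted_mult q f g) n = (\<Sum>i\<le>n. coeff f i * coeff g (n - i) ^ (q ^ i))"
proof -
  have inner: "(\<Sum>j\<le>degree g. coeff (monom (coeff f i * coeff g j ^ (q ^ i)) (i + j)) n)
      = (if i \<le> n then coeff f i * coeff g (n - i) ^ (q ^ i) else 0)" for i
  proof (cases "i \<le> n")
    case True
    have "(\<Sum>j\<le>degree g. coeff (monom (coeff f i * coeff g j ^ (q ^ i)) (i + j)) n)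
        = (\<Sum>j\<le>degree g. if j = n - i then coeff f i * coeff g j ^ (q ^ i) else 0)"
      using True by (intro sum.cong) auto
    also have "\<dots> = coeff f i * coeff g (n - i) ^ (q ^ i)"
      using assms by (auto simp: sum.delta coeff_eq_0 power_0_left)
    finally show ?thesis using True by simp
  qed (auto intro!: sum.neutral)
  have "coeff (twisted_mult q f g) n
      = (\<Sum>i\<le>degree f. if i \<le> n then coeff f i * coeff g (n - i) ^ (q ^ i) else 0)"
    unfolding twisted_mult_def by (simp add: coeff_sum inner del: coeff_monom)
  also have "\<dots> = (\<Sum>i\<in>{..degree f} \<inter> {..n}. coeff f i * coeff g (n - i) ^ (q ^ i))"
    by (subst sum.inter_restrict) auto
  also have "\<dots> = (\<Sum>i\<le>n. coeff f i * coeff g (n - i) ^ (q ^ i))"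
    by (intro sum.mono_neutral_left) (auto simp: coeff_eq_0)
  finally show ?thesis .
qed

lemma twisted_mult_monom:
  assumes "q > 0"
  shows "twisted_mult q (monom a i) (monom b j) = monom (a * b ^ (q ^ i)) (i + j)"
proof (rule poly_eqI)
  fix n
  have "coeff (twisted_mult q (monom a i) (monom b j)) n
      = (\<Sum>k\<le>n. if k = i then a * coeff (monom b j) (n - i) ^ (q ^ i) else 0)"
    unfolding twisted_mult_coeff[OF assms] by (intro sum.cong) auto
  also have "\<dots> = coeff (monom (a * b ^ (q ^ i)) (i + j)) n"
    using assms by (auto simp: power_0_left)
  finally show "coeff (twisted_mult q (monom a i) (monom b j)) n
      = coeff (monom (a * b ^ (q ^ i)) (i + j)) n" .
qed

lemma twisted_mult_assoc:
  fixes f g h :: "'l::field poly"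
  assumes q: "q > 0" and add: "\<And>x y :: 'l. (x + y) ^ q = x ^ q + y ^ q"
  shows "twisted_mult q (twisted_mult q f g) h = twisted_mult q f (twisted_mult q g h)"
proof (rule poly_eqI)
  fix n
  have add': "(x + y) ^ (q ^ k) = x ^ (q ^ k) + y ^ (q ^ k)" for x y :: 'l and k
    by (induction k) (simp_all add: power_mult add mult.commute[of q])
  have sum': "(sum F B) ^ (q ^ k) = (\<Sum>b\<in>B. F b ^ (q ^ k))" for F :: "nat \<Rightarrow> 'l" and B k
    using q by (induction B rule: infinite_finite_induct) (auto simp: add' power_0_left)
  have "coeff (twisted_mult q (twisted_mult q f g) h) n
     = (\<Sum>k\<le>n. \<Sum>i\<le>k. coeff f i * coeff g (k - i) ^ (q ^ i) * coeff h (n - k) ^ (q ^ k))"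
    by (simp add: twisted_mult_coeff[OF q] sum_distrib_right)
  also have "\<dots> = (\<Sum>(k, i)\<in>(SIGMA k:{..n}. {..k}).
      coeff f i * coeff g (k - i) ^ (q ^ i) * coeff h (n - k) ^ (q ^ k))"
    by (simp add: sum.Sigma)
  also have "\<dots> = (\<Sum>(i, j)\<in>(SIGMA i:{..n}. {..n - i}).
      coeff f i * coeff g j ^ (q ^ i) * coeff h (n - i - j) ^ (q ^ (i + j)))"
    by (rule sum.reindex_bij_witness[where i = "\<lambda>(i, j). (i + j, i)" and j = "\<lambda>(k, i). (i, k - i)"])
       auto
  also have "\<dots> = (\<Sum>i\<le>n. \<Sum>j\<le>n - i.
      coeff f i * coeff g j ^ (q ^ i) * coeff h (n - i - j) ^ (q ^ (i + j)))"
    by (simp add: sum.Sigma)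
  also have "\<dots> = coeff (twisted_mult q f (twisted_mult q g h)) n"
    by (simp add: twisted_mult_coeff[OF q] sum' sum_distrib_left power_mult_distrib
        power_add power_mult mult.assoc flip: power_mult)
       (simp add: mult.commute)
  finally show "coeff (twisted_mult q (twisted_mult q f g) h) n
      = coeff (twisted_mult q f (twisted_mult q g h)) n" .
qed

lemma ring_twisted_poly_ring:
  assumes q: "q > 0" and add: "\<And>x y :: 'l::field. (x + y) ^ q = x ^ q + y ^ q"
  shows "ring (twisted_poly_ring q :: 'l poly ring)"
proof -
  have add': "(x + y) ^ (q ^ k) = x ^ (q ^ k) + y ^ (q ^ k)" for x y :: 'l and k
    by (induction k) (simp_all add: power_mult add mult.commute[of q])
  have inv: "\<exists>y. x + y = 0" for x :: "'l poly"
    by (rule exI[of _ "- x"]) simp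
  have one_left: "twisted_mult q 1 f = f" for f :: "'l poly"
  proof (rule poly_eqI)
    fix n
    have "coeff (twisted_mult q 1 f) n = (\<Sum>i\<le>n. if i = 0 then coeff f n else 0)"
      unfolding twisted_mult_coeff[OF q] by (intro sum.cong) auto
    thus "coeff (twisted_mult q 1 f) n = coeff f n" by simp
  qed
  have one_right: "twisted_mult q f 1 = f" for f :: "'l poly"
  proof (rule poly_eqI)
    fix n
    have "coeff (twisted_mult q f 1) n = (\<Sum>i\<le>n. if i = n then coeff f n else 0)"
      unfolding twisted_mult_coeff[OF q] using q
      by (intro sum.cong) (auto simp: power_0_left)
    thus "coeff (twisted_mult q f 1) n = coeff f n" by simp
  qed
  show ?thesis
  proof (rule ringI)
    show "abelian_group (twisted_poly_ring q :: 'l poly ring)"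
      by (rule abelian_groupI) (auto simp: twisted_poly_ring_def inv add_ac)
    show "Group.monoid (twisted_poly_ring q :: 'l poly ring)"
      by (rule monoidI)
         (auto simp: twisted_poly_ring_def one_left one_right twisted_mult_assoc[OF q add])
  qed (auto simp: twisted_poly_ring_def poly_eq_iff twisted_mult_coeff[OF q] add'
        algebra_simps sum.distrib)
qed


section \<open>Drinfeld modules\<close>

text \<open>
  The constant field is a type \<open>'k\<close> of class \<open>finite_field\<close>, with \<open>q = CARD('k)\<close>, and \<open>T\<close> is
  \<open>[:0, 1:] :: 'k poly\<close>.  Elements of \<^const>\<open>ring_hom\<close> preserve 1, so the structure map of an
  \<open>\<A>\<close>-field is automatically nonzero.
\<close>

definition A_field :: "('k::finite_field poly \<Rightarrow> 'l::field) \<Rightarrow> bool" where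
  "A_field \<iota> \<longleftrightarrow> \<iota> \<in> ring_hom ring_of_type_algebra ring_of_type_algebra"

definition drinfeld_module ::
  "('k::finite_field poly \<Rightarrow> 'l::field) \<Rightarrow> nat \<Rightarrow> (nat \<Rightarrow> 'l) \<Rightarrow> ('k poly \<Rightarrow> 'l poly) \<Rightarrow> bool" where
  "drinfeld_module \<iota> r A \<phi> \<longleftrightarrow>
     A_field \<iota> \<and> r \<ge> 1 \<and> A r \<noteq> 0 \<and>
     \<phi> \<in> ring_hom ring_of_type_algebra (twisted_poly_ring CARD('k)) \<and>
     (\<forall>c a. \<phi> (smult c a) = smult (\<iota> [:c:]) (\<phi> a)) \<and>
     \<phi> [:0, 1:] = monom (\<iota> [:0, 1:]) 0 + (\<Sum>i=1..r. monom (A i) i)"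

definition drinfeld_coeff :: "nat \<Rightarrow> ('k::finite_field poly \<Rightarrow> 'l::field poly) \<Rightarrow> int \<Rightarrow> nat \<Rightarrow> 'l" where
  "drinfeld_coeff r \<phi> n m =
     (if 0 \<le> n \<and> n \<le> int (r * m) then coeff (\<phi> ([:0, 1:] ^ m)) (nat n) else 0)"

lemma finite_field_card:
  obtains e where "CARD('k::finite_field) = CHAR('k) ^ e"
proof -
  have char: "l = CHAR('k)" if l: "prime l" "l dvd CARD('k)" for l
  proof -
    define G where "G = \<lparr>carrier = (UNIV :: 'k set), monoid.mult = (+), one = (0 :: 'k)\<rparr>"
    interpret G: group G
    proof (rule groupI)
      fix x assume "x \<in> carrier G"
      show "\<exists>y\<in>carrier G. y \<otimes>\<^bsub>G\<^esub> x = \<one>\<^bsub>G\<^esub>"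
        by (intro bexI[of _ "-x"]) (auto simp: G_def)
    qed (auto simp: G_def add_ac)
    obtain m where m: "CARD('k) = l * m" using l(2) by auto
    have "\<exists>H. subgroup H G \<and> card H = l ^ 1"
      by (rule sylow_thm[OF l(1) G.group_axioms, of 1 m]) (auto simp: G_def Coset.order_def m)
    then obtain H where H: "subgroup H G" "card H = l" by auto
    have "H \<noteq> {0}" using H(2) l(1) by auto
    moreover have "0 \<in> H" using subgroup.one_closed[OF H(1)] by (simp add: G_def)
    ultimately obtain x where x: "x \<in> H" "x \<noteq> 0" by auto
    have pow: "x [^]\<^bsub>G\<^esub> (k::nat) = of_nat k * x" for k
      by (induction k) (auto simp: G_def algebra_simps)
    interpret H: group "G\<lparr>carrier := H\<rparr>" by (rule G.subgroup_imp_group[OF H(1)])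
    have "x [^]\<^bsub>G\<lparr>carrier := H\<rparr>\<^esub> Coset.order (G\<lparr>carrier := H\<rparr>) = \<one>\<^bsub>G\<lparr>carrier := H\<rparr>\<^esub>"
      by (rule H.pow_order_eq_1) (use x in auto)
    hence "x [^]\<^bsub>G\<^esub> l = \<one>\<^bsub>G\<^esub>"
      using H(2) by (simp add: Coset.order_def nat_pow_def)
    hence "of_nat l = (0 :: 'k)" using x by (simp add: pow) (simp add: G_def)
    hence "CHAR('k) dvd l" by (simp add: of_nat_eq_0_iff_char_dvd)
    thus ?thesis using l(1) using CHAR_prime[where 'a = 'k] by (metis primes_dvd_imp_eq)
  qed
  have "prime_factors CARD('k) \<subseteq> {CHAR('k)}"
    using char by (auto simp: in_prime_factors_iff)
  hence "set_mset (prime_factorization CARD('k)) \<subseteq> {CHAR('k)}" .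
  hence "prime_factorization CARD('k)
      = replicate_mset (size (prime_factorization CARD('k))) CHAR('k)"
    by (metis set_mset_subset_singletonD)
  hence "prod_mset (prime_factorization CARD('k))
      = CHAR('k) ^ size (prime_factorization CARD('k))"
    by (metis prod_mset_replicate_mset)
  hence "CARD('k) = CHAR('k) ^ size (prime_factorization CARD('k))"
    by (simp add: prod_mset_prime_factorization_nat)
  thus ?thesis using that by blast
qed

lemma A_field_Frobenius_add:
  fixes \<iota> :: "'k::finite_field poly \<Rightarrow> 'l::field"
  assumes "A_field \<iota>"
  shows "(x + y :: 'l) ^ CARD('k) = x ^ CARD('k) + y ^ CARD('k)"
proof -
  have hom: "\<iota> (a + b) = \<iota> a + \<iota> b" "\<iota> 1 = 1" for a b
    using assms by (auto simp: A_field_def ring_hom_def ring_of_type_algebra_def)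
  have zero: "\<iota> 0 = 0" using hom(1)[of 0 0] by (simp only: add_0_right add_cancel_right_right)
  have of_nat: "\<iota> (of_nat n) = of_nat n" for n
    by (induction n) (auto simp: hom zero)
  have "of_nat CHAR('k) = (0 :: 'k poly)"
    using of_nat_CHAR[where 'a = "'k poly"] by simp
  hence "of_nat CHAR('k) = (0 :: 'l)" using of_nat[of "CHAR('k)"] zero by simp
  hence "CHAR('l) dvd CHAR('k)" by (simp add: of_nat_eq_0_iff_char_dvd)
  moreover have "CHAR('l) \<noteq> 1" by simp
  ultimately have char: "CHAR('l) = CHAR('k)"
    using CHAR_prime[where 'a = 'k] by (auto simp: prime_nat_iff)
  obtain e where "CARD('k) = CHAR('k) ^ e" by (rule finite_field_card)
  thus ?thesis using char by (intro freshmans_dream'[of _ e]) auto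
qed

lemma A_field_ring_twisted_poly_ring:
  fixes \<iota> :: "'k::finite_field poly \<Rightarrow> 'l::field"
  assumes "A_field \<iota>"
  shows "ring (twisted_poly_ring CARD('k) :: 'l poly ring)"
  by (rule ring_twisted_poly_ring) (auto simp: A_field_Frobenius_add[OF assms])

lemma drinfeld_coeff_expansion:
  fixes \<phi> :: "'k::finite_field poly \<Rightarrow> 'l::field poly"
  assumes "drinfeld_module \<iota> r A \<phi>"
  shows "\<phi> ([:0, 1:] ^ m) = (\<Sum>n=0..r * m. monom (drinfeld_coeff r \<phi> (int n) m) n)"
proof -
  have q: "CARD('k) > 0" by simp
  have mult: "\<phi> (a * b) = twisted_mult CARD('k) (\<phi> a) (\<phi> b)" and one: "\<phi> 1 = 1" for a b
    using assms
    by (auto simp: drinfeld_module_def ring_hom_def ring_of_type_algebra_def twisted_poly_ring_def)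
  have T: "\<phi> [:0, 1:] = monom (\<iota> [:0, 1:]) 0 + (\<Sum>i=1..r. monom (A i) i)"
    using assms by (simp add: drinfeld_module_def)
  have "degree (\<phi> [:0, 1:]) \<le> r"
    unfolding T
    by (intro degree_add_le degree_sum_le) (auto intro: order.trans[OF degree_monom_le])
  hence T0: "coeff (\<phi> [:0, 1:]) i = 0" if "i > r" for i
    using that by (simp add: coeff_eq_0)
  have deg: "coeff (\<phi> ([:0, 1:] ^ m)) n = 0" if "n > r * m" for n
    using that
  proof (induction m arbitrary: n)
    case (Suc m)
    have "coeff (\<phi> [:0, 1:]) i * coeff (\<phi> ([:0, 1:] ^ m)) (n - i) ^ (CARD('k) ^ i) = 0" for i
    proof (cases "i > r")
      case False
      hence "n - i > r * m" using Suc.prems by (auto simp: algebra_simps)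
      thus ?thesis using Suc.IH by simp
    qed (auto simp: T0)
    hence "coeff (twisted_mult CARD('k) (\<phi> [:0, 1:]) (\<phi> ([:0, 1:] ^ m))) n = 0"
      unfolding twisted_mult_coeff[OF q] by (intro sum.neutral) blast
    thus ?case by (simp only: power_Suc mult)
  qed (auto simp: one)
  show ?thesis
  proof (rule poly_eqI)
    fix k
    have "coeff (\<Sum>n=0..r * m. monom (drinfeld_coeff r \<phi> (int n) m) n) k
        = (\<Sum>n=0..r * m. if n = k then drinfeld_coeff r \<phi> (int k) m else 0)"
      unfolding coeff_sum by (intro sum.cong) auto
    also have "\<dots> = coeff (\<phi> ([:0, 1:] ^ m)) k"
      using deg[of k] by (auto simp: drinfeld_coeff_def simp flip: of_nat_mult)
    finally show "coeff (\<phi> ([:0, 1:] ^ m)) k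
        = coeff (\<Sum>n=0..r * m. monom (drinfeld_coeff r \<phi> (int n) m) n) k" by simp
  qed
qed


section \<open>Weights and the sums h\<close>

definition weight :: "nat \<Rightarrow> nat set \<Rightarrow> nat" where
  "weight q S = (\<Sum>i\<in>S. q ^ i)"

text \<open>Families indexed by \<open>S\<close> are extensional functions, so that each is counted once.\<close>

definition index_families :: "int \<Rightarrow> nat set \<Rightarrow> (nat \<Rightarrow> nat) set" where
  "index_families n S = {k \<in> S \<rightarrow>\<^sub>E UNIV. int (\<Sum>i\<in>S. k i) = n}"

definition h_sum :: "nat \<Rightarrow> 'l::field \<Rightarrow> nat set \<Rightarrow> int \<Rightarrow> 'l" where
  "h_sum q t S n = (\<Sum>k\<in>index_families n S. t ^ (\<Sum>i\<in>S. k i * q ^ i))"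

lemma finite_index_families:
  assumes "finite S"
  shows "finite (index_families n S)"
proof (rule finite_subset)
  show "index_families n S \<subseteq> S \<rightarrow>\<^sub>E {..nat n}"
  proof
    fix k assume k: "k \<in> index_families n S"
    hence n: "nat n = (\<Sum>i\<in>S. k i)"
      by (auto simp: index_families_def simp del: of_nat_sum)
    have "k i \<le> nat n" if "i \<in> S" for i
      unfolding n using that assms by (intro member_le_sum) auto
    thus "k \<in> S \<rightarrow>\<^sub>E {..nat n}"
      using k by (auto simp: index_families_def PiE_iff)
  qed
qed (use assms in \<open>auto intro: finite_PiE\<close>)

lemma index_families_neg: "n < 0 \<Longrightarrow> index_families n S = {}"
  by (auto simp: index_families_def simp del: of_nat_sum)

lemma index_families_empty: "index_families n {} = (if n = 0 then {\<lambda>_. undefined} else {})"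
  by (auto simp: index_families_def)


section \<open>Shadowed partitions\<close>

text \<open>
  A tuple \<open>(S\<^sub>1, \<dots>, S\<^sub>r)\<close> is an extensional function on \<open>{1..r}\<close>.  The condition that the shifts
  \<open>S\<^sub>i + j\<close> partition \<open>{0, \<dots>, n - 1}\<close> refers to the indexed family: members with different indices
  \<open>(i, j)\<close> are disjoint, and members may be empty.
\<close>

definition shadowed_partitions :: "nat \<Rightarrow> nat \<Rightarrow> (nat \<Rightarrow> nat set) set" where
  "shadowed_partitions r n =
     {S \<in> {1..r} \<rightarrow>\<^sub>E Pow {..<n}.
        disjoint_family_on (\<lambda>(i, j). (\<lambda>s. s + j) ` S i) (SIGMA i:{1..r}. {0..i - 1}) \<and>
        (\<Union>(i, j)\<in>(SIGMA i:{1..r}. {0..i - 1}). (\<lambda>s. s + j) ` S i) = {..<n}}"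

definition sp_size :: "nat \<Rightarrow> (nat \<Rightarrow> nat set) \<Rightarrow> nat" where
  "sp_size r S = (\<Sum>i=1..r. card (S i))"

definition sp_support :: "nat \<Rightarrow> (nat \<Rightarrow> nat set) \<Rightarrow> nat set" where
  "sp_support r S = (\<Union>i\<in>{1..r}. S i)"

definition sp_power :: "nat \<Rightarrow> nat \<Rightarrow> (nat \<Rightarrow> 'l::field) \<Rightarrow> (nat \<Rightarrow> nat set) \<Rightarrow> 'l" where
  "sp_power q r A S = (\<Prod>i=1..r. A i ^ weight q (S i))"

lemma finite_shadowed_partitions: "finite (shadowed_partitions r n)"
  by (rule finite_subset[of _ "{1..r} \<rightarrow>\<^sub>E Pow {..<n}"])
     (auto simp: shadowed_partitions_def intro: finite_PiE)

lemma finite_sp_support: "S \<in> shadowed_partitions r n \<Longrightarrow> finite (sp_support r S)"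
  by (auto simp: shadowed_partitions_def sp_support_def PiE_iff intro: finite_subset)

lemma shadowed_partitions_0: "shadowed_partitions r 0 = {\<lambda>i\<in>{1..r}. {}}"
  by (auto simp: shadowed_partitions_def disjoint_family_on_def PiE_iff extensional_def fun_eq_iff)

end

theory Submission
  imports Defs
begin

text \<open>
  Expanding \<open>\<phi>\<^bsub>T\<^sup>m\<^sup>+\<^sup>1\<^esub> = \<phi>\<^bsub>T\<^sup>m\<^esub> \<phi>\<^bsub>T\<^esub>\<close> gives
  \<open>c(n; m + 1) = T\<^bsup>q^n\<^esup> c(n; m) + \<Sum>\<^sub>i A\<^sub>i\<^bsup>q^(n - i)\<^esup> c(n - i; m)\<close>, and the right-hand side of the
  theorem obeys the same recursion.  Splitting off the exponent at \<open>n\<close> writes \<open>h\<close> for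
  \<open>\<Union>S \<union> {n}\<close> as \<open>T\<^bsup>q^n\<^esup>\<close> times its predecessor plus \<open>h\<close> for \<open>\<Union>S\<close>.  In a shadowed partition of
  \<open>n > 0\<close> the point \<open>n - 1\<close> can only be covered by \<open>n - i \<in> S\<^sub>i\<close> for a unique \<open>i\<close>, and removing
  that point leaves an arbitrary shadowed partition of \<open>n - i\<close>; so \<open>\<Union>S\<close> becomes \<open>\<Union>S' \<union> {n - i}\<close>.
\<close>

section \<open>The sums h as complete homogeneous symmetric polynomials\<close>

lemma h_sum_neg: "n < 0 \<Longrightarrow> h_sum q t S n = 0"
  by (simp add: h_sum_def index_families_neg)

lemma h_sum_empty: "h_sum q t {} n = (if n = 0 then 1 else 0)"
  by (simp add: h_sum_def index_families_empty)

lemma h_sum_zero: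
  assumes "finite S"
  shows "h_sum q t S 0 = 1"
proof -
  have "index_families 0 S = {\<lambda>i\<in>S. 0}"
    using assms by (auto simp: index_families_def PiE_iff extensional_def fun_eq_iff
        simp del: of_nat_sum)
  thus ?thesis by (simp add: h_sum_def)
qed

text \<open>For finite \<open>S\<close>, \<open>h_sum q t S n\<close> is the complete homogeneous
  symmetric polynomial of degree \<open>n\<close> in the variables \<open>t ^ (q ^ i)\<close>,
  \<open>i\<close> in \<open>S\<close>; this is its usual recurrence. Families with
  \<open>k a = 0\<close> live on \<open>S\<close>; in the others, lowering \<open>k a\<close> by one
  splits off one factor \<open>t ^ (q ^ a)\<close>.\<close>

lemma h_sum_insert:
  assumes S: "finite S" "a \<notin> S"
  shows "h_sum q t (insert a S) n = h_sum q t S n + t ^ (q ^ a) * h_sum q t (insert a S) (n - 1)"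
proof -
  let ?f = "\<lambda>k. t ^ (\<Sum>i\<in>insert a S. k i * q ^ i)"
  let ?I = "index_families n (insert a S)"
  have fin: "finite ?I" using S by (intro finite_index_families) auto
  have cong: "sum (k(a := v)) S = sum k S" for k :: "nat \<Rightarrow> nat" and v
    using S by (intro sum.cong) auto
  hence cong_if: "(\<Sum>i\<in>S. if i = a then v else k i) = sum k S" for k :: "nat \<Rightarrow> nat" and v
    by (simp add: fun_upd_def)
  have cong': "(\<Sum>i\<in>S. (k(a := v)) i * q ^ i) = (\<Sum>i\<in>S. k i * q ^ i)" for k :: "nat \<Rightarrow> nat" and v
    using S by (intro sum.cong) auto
  have "sum ?f ?I = sum ?f {k\<in>?I. k a = 0} + sum ?f {k\<in>?I. k a \<noteq> 0}"
    using fin by (subst sum.union_disjoint[symmetric]) (auto intro!: sum.cong)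
  also have "sum ?f {k\<in>?I. k a = 0} = h_sum q t S n"
    unfolding h_sum_def
  \<comment> \<open>Families are extensional, so discarding the index \<open>a\<close> means
    resetting the value there to \<open>undefined\<close>.\<close>
  proof (rule sum.reindex_bij_witness[where i = "\<lambda>k. k(a := 0)" and j = "\<lambda>k. k(a := undefined)"])
    fix k assume k: "k \<in> {k\<in>?I. k a = 0}"
    show "(k(a := undefined))(a := 0) = k" using k by auto
    show "k(a := undefined) \<in> index_families n S"
      using k S by (auto simp: index_families_def PiE_iff extensional_def cong_if simp del: of_nat_sum)
    show "t ^ (\<Sum>i\<in>S. (k(a := undefined)) i * q ^ i) = ?f k"
      using k S by (simp only: cong') simp
  next
    fix k assume k: "k \<in> index_families n S"
    show "(k(a := 0))(a := undefined) = k"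
      using k S by (auto simp: index_families_def PiE_iff extensional_def)
    show "k(a := 0) \<in> {k\<in>?I. k a = 0}"
      using k S by (auto simp: index_families_def PiE_iff extensional_def cong_if simp del: of_nat_sum)
  qed
  also have "sum ?f {k\<in>?I. k a \<noteq> 0}
      = (\<Sum>k\<in>index_families (n - 1) (insert a S). t ^ (q ^ a) * ?f k)"
  proof (rule sum.reindex_bij_witness[where i = "\<lambda>k. k(a := Suc (k a))" and j = "\<lambda>k. k(a := k a - 1)"])
    fix k assume k: "k \<in> {k\<in>?I. k a \<noteq> 0}"
    then obtain v where v: "k a = Suc v" by (auto simp: gr0_conv_Suc)
    show "(k(a := k a - 1))(a := Suc ((k(a := k a - 1)) a)) = k" using v by auto
    show "k(a := k a - 1) \<in> index_families (n - 1) (insert a S)"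
      using k S v by (auto simp: index_families_def PiE_iff extensional_def cong_if simp del: of_nat_sum)
    have "(\<Sum>i\<in>insert a S. (k(a := k a - 1)) i * q ^ i) = v * q ^ a + (\<Sum>i\<in>S. k i * q ^ i)"
      unfolding sum.insert[OF S] cong' using v by simp
    moreover have "(\<Sum>i\<in>insert a S. k i * q ^ i) = q ^ a + (v * q ^ a + (\<Sum>i\<in>S. k i * q ^ i))"
      unfolding sum.insert[OF S] using v by simp
    ultimately show "t ^ (q ^ a) * ?f (k(a := k a - 1)) = ?f k" by (simp only: power_add)
  next
    fix k assume k: "k \<in> index_families (n - 1) (insert a S)"
    show "(k(a := Suc (k a)))(a := (k(a := Suc (k a))) a - 1) = k" by auto
    show "k(a := Suc (k a)) \<in> {k\<in>?I. k a \<noteq> 0}"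
      using k S by (auto simp: index_families_def PiE_iff extensional_def cong_if simp del: of_nat_sum)
  qed
  finally show ?thesis by (simp add: h_sum_def sum_distrib_left)
qed

section \<open>Shadowed partitions as tilings by intervals\<close>

text \<open>A point \<open>s\<close> of \<open>S i\<close> stands for the block of length
  \<open>i\<close> starting at \<open>s\<close>, and the blocks tile \<open>{..<n}\<close>. Each
  block ends by \<open>n\<close>, every point is covered, and a covered point determines the pair
  \<open>(i, j)\<close>, hence also the start \<open>s\<close> of its block.\<close>

lemma mem_shadowed_partitions_iff:
  "S \<in> shadowed_partitions r n \<longleftrightarrow>
     S \<in> extensional {1..r} \<and>
     (\<forall>i\<in>{1..r}. \<forall>s\<in>S i. s + i \<le> n) \<and>
     (\<forall>x<n. \<exists>i\<in>{1..r}. \<exists>j<i. \<exists>s\<in>S i. x = s + j) \<and>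
     (\<forall>i\<in>{1..r}. \<forall>i'\<in>{1..r}. \<forall>s\<in>S i. \<forall>s'\<in>S i'. \<forall>j<i. \<forall>j'<i'.
        s + j = s' + j' \<longrightarrow> i = i' \<and> j = j')" (is "_ \<longleftrightarrow> ?ext \<and> ?bound \<and> ?cover \<and> ?uniq")
proof -
  let ?D = "SIGMA i:{1..r}. {0..i - 1}"
  let ?F = "\<lambda>(i, j). (\<lambda>s. s + j) ` S i"
  have ij: "(i, j) \<in> ?D \<longleftrightarrow> i \<in> {1..r} \<and> j < i" for i j by auto
  have "disjoint_family_on ?F ?D \<longleftrightarrow>
      (\<forall>p p'. p \<in> ?D \<longrightarrow> p' \<in> ?D \<longrightarrow> p \<noteq> p' \<longrightarrow> ?F p \<inter> ?F p' = {})"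
    unfolding disjoint_family_on_def by blast
  also have "\<dots> \<longleftrightarrow>
      (\<forall>i j i' j'. (i, j) \<in> ?D \<longrightarrow> (i', j') \<in> ?D \<longrightarrow> (i, j) \<noteq> (i', j') \<longrightarrow>
         (\<forall>s\<in>S i. \<forall>s'\<in>S i'. s + j \<noteq> s' + j'))"
    unfolding split_paired_All prod.case by blast
  also have "\<dots> \<longleftrightarrow> ?uniq" unfolding ij by blast
  finally have uniq: "disjoint_family_on ?F ?D \<longleftrightarrow> ?uniq" .
  have in_Un: "x \<in> (\<Union>p\<in>?D. ?F p) \<longleftrightarrow> (\<exists>i\<in>{1..r}. \<exists>j<i. \<exists>s\<in>S i. x = s + j)" for x
  proof -
    have "x \<in> (\<Union>p\<in>?D. ?F p) \<longleftrightarrow> (\<exists>i j. (i, j) \<in> ?D \<and> (\<exists>s\<in>S i. x = s + j))"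
      unfolding UN_iff Bex_def split_paired_Ex prod.case image_iff ..
    thus ?thesis unfolding ij by blast
  qed
  \<comment> \<open>Among the shifts of \<open>s\<close> the largest is by \<open>i - 1\<close>, so
    only this one has to be tested.\<close>
  have bound: "(\<forall>i\<in>{1..r}. \<forall>j<i. \<forall>s\<in>S i. s + j < n) \<longleftrightarrow> ?bound"
  proof (intro iffI ballI allI impI)
    fix i s assume "\<forall>i\<in>{1..r}. \<forall>j<i. \<forall>s\<in>S i. s + j < n" "i \<in> {1..r}" "s \<in> S i"
    moreover from this have "i - 1 < i" by auto
    ultimately have "s + (i - 1) < n" by blast
    thus "s + i \<le> n" using \<open>i \<in> {1..r}\<close> by auto
  next
    fix i j s assume "?bound" "i \<in> {1..r}" "j < i" "s \<in> S i"
    thus "s + j < n" by (meson add_less_cancel_left order_less_le_trans)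
  qed
  have "(\<Union>p\<in>?D. ?F p) = {..<n} \<longleftrightarrow> (\<forall>i\<in>{1..r}. \<forall>j<i. \<forall>s\<in>S i. s + j < n) \<and> ?cover"
    unfolding set_eq_iff in_Un lessThan_iff by blast
  hence un: "(\<Union>p\<in>?D. ?F p) = {..<n} \<longleftrightarrow> ?bound \<and> ?cover" unfolding bound .
  \<comment> \<open>As \<open>i \<ge> 1\<close>, a block that ends by \<open>n\<close> starts below
    \<open>n\<close>.\<close>
  have PiE: "S \<in> {1..r} \<rightarrow>\<^sub>E Pow {..<n} \<longleftrightarrow> ?ext" if ?bound
    using that by (force simp: PiE_iff)
  show ?thesis
    unfolding shadowed_partitions_def mem_Collect_eq uniq un using PiE by blast
qed

lemma shadowed_partitionsI:
  assumes "S \<in> extensional {1..r}"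
    and "\<And>i s. i \<in> {1..r} \<Longrightarrow> s \<in> S i \<Longrightarrow> s + i \<le> n"
    and "\<And>x. x < n \<Longrightarrow> \<exists>i\<in>{1..r}. \<exists>j<i. \<exists>s\<in>S i. x = s + j"
    and "\<And>i i' s s' j j'. i \<in> {1..r} \<Longrightarrow> i' \<in> {1..r} \<Longrightarrow> s \<in> S i \<Longrightarrow> s' \<in> S i' \<Longrightarrow>
      j < i \<Longrightarrow> j' < i' \<Longrightarrow> s + j = s' + j' \<Longrightarrow> i = i' \<and> j = j'"
  shows "S \<in> shadowed_partitions r n"
  unfolding mem_shadowed_partitions_iff
  by (intro conjI ballI allI impI) (use assms in \<open>assumption | blast\<close>)+

lemma shadowed_partitions_extensional: "S \<in> shadowed_partitions r n \<Longrightarrow> S \<in> extensional {1..r}"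
  by (simp add: shadowed_partitions_def PiE_def)

lemma shadowed_partitions_bound:
  "S \<in> shadowed_partitions r n \<Longrightarrow> i \<in> {1..r} \<Longrightarrow> s \<in> S i \<Longrightarrow> s + i \<le> n"
  unfolding mem_shadowed_partitions_iff by blast

lemma shadowed_partitions_cover:
  assumes "S \<in> shadowed_partitions r n" "x < n"
  obtains i j s where "i \<in> {1..r}" "j < i" "s \<in> S i" "x = s + j"
  using assms unfolding mem_shadowed_partitions_iff by blast

lemma shadowed_partitions_unique:
  assumes "S \<in> shadowed_partitions r n" "i \<in> {1..r}" "i' \<in> {1..r}" "s \<in> S i" "s' \<in> S i'"
    "j < i" "j' < i'" "s + j = s' + j'"
  shows "i = i' \<and> j = j'"
  using assms(1)[unfolded mem_shadowed_partitions_iff, THEN conjunct2, THEN conjunct2, THEN conjunct2]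
    assms(2-) by blast

lemma sp_support_subset: "S \<in> shadowed_partitions r n \<Longrightarrow> sp_support r S \<subseteq> {..<n}"
  by (auto simp: shadowed_partitions_def sp_support_def PiE_iff)

lemma finite_shadowed_partition_component:
  assumes "S \<in> shadowed_partitions r n" "i \<in> {1..r}"
  shows "finite (S i)"
proof (rule finite_subset)
  show "S i \<subseteq> sp_support r S" using assms(2) unfolding sp_support_def by blast
qed (rule finite_sp_support[OF assms(1)])

section \<open>Adding and removing the last block\<close>

text \<open>The blocks of \<open>S\<close> fill \<open>{..<n - i}\<close>, and the new block of
  length \<open>i\<close> starting at \<open>n - i\<close> fills exactly the remaining gap.\<close>

lemma shadowed_partitions_insert:
  assumes S: "S \<in> shadowed_partitions r (n - i)" and i: "i \<in> {1..r}" "i \<le> n"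
  shows "S(i := insert (n - i) (S i)) \<in> shadowed_partitions r n" (is "?S' \<in> _")
proof -
  note bound = shadowed_partitions_bound[OF S]
  have cover: "\<exists>k\<in>{1..r}. \<exists>j<k. \<exists>s\<in>?S' k. x = s + j" if "x < n" for x
  proof (cases "x < n - i")
    case True
    then obtain k j s where "k \<in> {1..r}" "j < k" "s \<in> S k" "x = s + j"
      by (rule shadowed_partitions_cover[OF S])
    thus ?thesis by (intro bexI[of _ k] exI[of _ j] conjI bexI[of _ s]) auto
  next
    case False
    thus ?thesis using that i
      by (intro bexI[of _ i] exI[of _ "x - (n - i)"] conjI bexI[of _ "n - i"]) auto
  qed
  have mem: "s \<in> ?S' k \<longleftrightarrow> s \<in> S k \<or> k = i \<and> s = n - i" for s k by auto
  have uniq: "k = k' \<and> j = j'"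
    if asm: "k \<in> {1..r}" "k' \<in> {1..r}" "s \<in> ?S' k" "s' \<in> ?S' k'" "j < k" "j' < k'" "s + j = s' + j'"
    for k k' s s' j j'
  proof -
    \<comment> \<open>In the two mixed cases an old block stays below \<open>n - i\<close> while the
      new one starts there, so they have no common point.\<close>
    consider "s \<in> S k" "s' \<in> S k'" | "s \<in> S k" "k' = i" "s' = n - i"
      | "k = i" "s = n - i" "s' \<in> S k'" | "k = i" "k' = i" "s = n - i" "s' = n - i"
      using asm(3,4) unfolding mem by blast
    thus ?thesis
    proof cases
      case 1
      thus ?thesis using shadowed_partitions_unique[OF S] asm by blast
    next
      case 2
      thus ?thesis using bound[OF asm(1) 2(1)] asm 2 by linarith
    next
      case 3
      thus ?thesis using bound[OF asm(2) 3(3)] asm 3 by linarith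
    next
      case 4
      thus ?thesis using asm by auto
    qed
  qed
  have ext: "?S' \<in> extensional {1..r}"
    using shadowed_partitions_extensional[OF S] i by (auto simp: extensional_def)
  have bound': "s + k \<le> n" if "k \<in> {1..r}" "s \<in> ?S' k" for k s
    using that bound[OF that(1)] i unfolding mem by fastforce
  show ?thesis by (rule shadowed_partitionsI[OF ext bound' cover uniq])
qed

lemma shadowed_partitions_cover_last:
  assumes S: "S \<in> shadowed_partitions r n" and n: "n > 0"
  obtains i where "i \<in> {1..r}" "i \<le> n" "n - i \<in> S i"
proof -
  have "n - 1 < n" using n by simp
  then obtain i j s where i: "i \<in> {1..r}" "j < i" "s \<in> S i" "n - 1 = s + j"
    by (rule shadowed_partitions_cover[OF S])
  moreover have "s + i \<le> n" using shadowed_partitions_bound[OF S] i by blast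
  \<comment> \<open>From \<open>j < i\<close> and \<open>s + i \<le> n = s + j + 1\<close> it
    follows that \<open>j = i - 1\<close>: the block covering the last point ends there.\<close>
  ultimately have "s = n - i" "i \<le> n" by auto
  thus ?thesis using i that by blast
qed

text \<open>The block removed occupies everything from \<open>n - i\<close> up to \<open>n\<close>;
  the others are disjoint from it, so they must end by \<open>n - i\<close>, and they still cover
  all points below.\<close>

lemma shadowed_partitions_remove:
  assumes S: "S \<in> shadowed_partitions r n" and i: "i \<in> {1..r}" "i \<le> n" "n - i \<in> S i"
  shows "S(i := S i - {n - i}) \<in> shadowed_partitions r (n - i)" (is "?S' \<in> _")
proof -
  have mem: "s \<in> ?S' k \<longleftrightarrow> s \<in> S k \<and> \<not> (k = i \<and> s = n - i)" for s k by auto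
  note uniq = shadowed_partitions_unique[OF S]
  have bound: "s + k \<le> n - i" if k: "k \<in> {1..r}" and s: "s \<in> ?S' k" for k s
  proof (rule ccontr)
    assume less: "\<not> s + k \<le> n - i"
    have sk: "s \<in> S k" using s unfolding mem by blast
    have le: "s + k \<le> n" by (rule shadowed_partitions_bound[OF S k sk])
    show False
    \<comment> \<open>A block reaching beyond \<open>n - i\<close> meets the last block in the
      larger of \<open>s\<close> and \<open>n - i\<close>. Uniqueness at that point forces
      \<open>k = i\<close> and \<open>s = n - i\<close> in the first case, and
      \<open>s \<le> n - i\<close> in the second.\<close>
    proof (cases "s \<le> n - i")
      case True
      hence "k = i \<and> n - i - s = 0"
        using less i k sk by (intro uniq[of k i s "n - i"]) auto
      thus False using s True unfolding mem by auto
    next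
      case False
      hence "k = i \<and> 0 = s - (n - i)"
        using le i k sk by (intro uniq[of k i s "n - i"]) auto
      thus False using False by auto
    qed
  qed
  have cover: "\<exists>k\<in>{1..r}. \<exists>j<k. \<exists>s\<in>?S' k. x = s + j" if x: "x < n - i" for x
  proof -
    have "x < n" using x by simp
    then obtain k j s where k: "k \<in> {1..r}" "j < k" "s \<in> S k" "x = s + j"
      by (rule shadowed_partitions_cover[OF S])
    \<comment> \<open>The start \<open>s\<close> is at most \<open>x\<close>, hence different from
      the removed \<open>n - i\<close>.\<close>
    moreover have "s \<in> ?S' k" unfolding mem using k x by auto
    ultimately show ?thesis by blast
  qed
  have ext: "?S' \<in> extensional {1..r}"
    using shadowed_partitions_extensional[OF S] i by (auto simp: extensional_def)
  show ?thesis
  proof (rule shadowed_partitionsI[OF ext bound cover])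
    fix k k' s s' j j'
    assume "k \<in> {1..r}" "k' \<in> {1..r}" "s \<in> ?S' k" "s' \<in> ?S' k'" "j < k" "j' < k'" "s + j = s' + j'"
    thus "k = k' \<and> j = j'" unfolding mem by (elim conjE) (rule uniq)
  qed
qed

text \<open>The pair records the length \<open>i\<close> of the last block and the tiling before it.
  At \<open>n = 0\<close> there is no last block: the source is empty, but the empty tuple is a
  shadowed partition.\<close>

lemma bij_betw_shadowed_partitions:
  assumes n: "n > 0"
  shows "bij_betw (\<lambda>(i, S). S(i := insert (n - i) (S i)))
     (SIGMA i:{i\<in>{1..r}. i \<le> n}. shadowed_partitions r (n - i)) (shadowed_partitions r n)"
proof (rule bij_betw_imageI)
  have notin: "n - i \<notin> S i" if "S \<in> shadowed_partitions r (n - i)" "i \<in> {1..r}" for i S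
    using shadowed_partitions_bound[OF that(1,2)] that(2) by fastforce
  show "inj_on (\<lambda>(i, S). S(i := insert (n - i) (S i)))
     (SIGMA i:{i\<in>{1..r}. i \<le> n}. shadowed_partitions r (n - i))"
  proof (rule inj_onI, clarify)
    fix i i' S S'
    assume i: "i \<in> {1..r}" "i \<le> n" "i' \<in> {1..r}" "i' \<le> n"
      and S: "S \<in> shadowed_partitions r (n - i)" "S' \<in> shadowed_partitions r (n - i')"
      and eq: "S(i := insert (n - i) (S i)) = S'(i' := insert (n - i') (S' i'))"
    let ?U = "S(i := insert (n - i) (S i))"
    have U: "?U \<in> shadowed_partitions r n" using S(1) i by (intro shadowed_partitions_insert) auto
    have mem: "n - i \<in> ?U i" "n - i' \<in> ?U i'" by (simp, unfold eq, simp)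
    \<comment> \<open>Both inserted blocks cover the point \<open>n - 1\<close>, so uniqueness in
      the common image identifies their lengths.\<close>
    have "i - 1 < i" "i' - 1 < i'" "(n - i) + (i - 1) = (n - i') + (i' - 1)" using i by auto
    hence ii': "i = i'"
      using shadowed_partitions_unique[OF U i(1,3) mem] by blast
    \<comment> \<open>The inserted point is new on both sides, so it can be cancelled.\<close>
    have "S k = S' k" for k
      using fun_cong[OF eq, of k] notin[of S i] notin[of S' i'] S i
      by (cases "k = i") (auto simp: ii' insert_ident)
    thus "i = i' \<and> S = S'" using ii' by auto
  qed
  show "(\<lambda>(i, S). S(i := insert (n - i) (S i))) `
      (SIGMA i:{i\<in>{1..r}. i \<le> n}. shadowed_partitions r (n - i)) = shadowed_partitions r n"
  proof (intro equalityI subsetI)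
    fix U assume U: "U \<in> shadowed_partitions r n"
    obtain i where i: "i \<in> {1..r}" "i \<le> n" "n - i \<in> U i"
      by (rule shadowed_partitions_cover_last[OF U n])
    have "U = (\<lambda>(i, S). S(i := insert (n - i) (S i))) (i, U(i := U i - {n - i}))"
      using i by (auto simp: insert_absorb)
    thus "U \<in> (\<lambda>(i, S). S(i := insert (n - i) (S i))) `
      (SIGMA i:{i\<in>{1..r}. i \<le> n}. shadowed_partitions r (n - i))"
      using i shadowed_partitions_remove[OF U i] by blast
  qed (auto intro!: shadowed_partitions_insert)
qed

section \<open>Effect of a new block on size, support and power\<close>

lemma sp_insert:
  assumes S: "S \<in> shadowed_partitions r n" and i: "i \<in> {1..r}" and s: "s \<notin> S i"
  shows "sp_size r (S(i := insert s (S i))) = Suc (sp_size r S)"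
    and "sp_support r (S(i := insert s (S i))) = insert s (sp_support r S)"
    and "sp_power q r A (S(i := insert s (S i))) = A i ^ (q ^ s) * sp_power q r A S"
proof -
  note fin = finite_shadowed_partition_component[OF S i]
  show "sp_size r (S(i := insert s (S i))) = Suc (sp_size r S)"
    \<comment> \<open>Only the \<open>i\<close>-th summand changes; it is isolated first.\<close>
    unfolding sp_size_def sum.remove[OF finite_atLeastAtMost i] using fin s
    by (simp cong: sum.cong_simp)
  show "sp_support r (S(i := insert s (S i))) = insert s (sp_support r S)"
    unfolding sp_support_def using i by (auto split: if_splits)
  show "sp_power q r A (S(i := insert s (S i))) = A i ^ (q ^ s) * sp_power q r A S"
    unfolding sp_power_def prod.remove[OF finite_atLeastAtMost i] using fin s
    by (simp add: weight_def power_add mult.assoc cong: prod.cong_simp)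
qed

lemma sp_size_pos:
  assumes S: "S \<in> shadowed_partitions r n" and n: "n > 0"
  shows "sp_size r S > 0"
proof -
  obtain i where i: "i \<in> {1..r}" "n - i \<in> S i"
    using shadowed_partitions_cover_last[OF S n] by metis
  moreover have "finite (S i)"
    using finite_shadowed_partition_component[OF S] i by blast
  ultimately have "card (S i) > 0" by (auto simp: card_gt_0_iff)
  thus ?thesis unfolding sp_size_def using i by (intro sum_pos2[of _ i]) auto
qed

section \<open>Recursion for the right-hand side\<close>

text \<open>The right-hand side of the theorem with \<open>t\<close> for the image of T, kept as a
  function of \<open>n\<close> and \<open>m\<close> so that its recursion in \<open>m\<close> can be
  stated.\<close>

definition shadowed_sum :: "nat \<Rightarrow> nat \<Rightarrow> (nat \<Rightarrow> 'l::field) \<Rightarrow> 'l \<Rightarrow> nat \<Rightarrow> nat \<Rightarrow> 'l" where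
  "shadowed_sum q r A t n m = (\<Sum>S\<in>shadowed_partitions r n.
     sp_power q r A S * h_sum q t (sp_support r S \<union> {n}) (int m - int (sp_size r S)))"

text \<open>For \<open>n > 0\<close> every shadowed partition has positive size, so at
  \<open>m = 0\<close> all the indices of h are negative and the sums vanish.\<close>

lemma shadowed_sum_0: "shadowed_sum q r A t n 0 = (if n = 0 then 1 else 0)"
proof (cases "n = 0")
  case True
  thus ?thesis
    by (simp add: shadowed_sum_def shadowed_partitions_0 sp_size_def sp_support_def sp_power_def
        weight_def h_sum_zero)
next
  case False
  thus ?thesis
    unfolding shadowed_sum_def by (auto intro!: sum.neutral h_sum_neg sp_size_pos)
qed

text \<open>Group the partitions by their last block. Removing it lowers the size by one, which
  turns \<open>Suc m\<close> into \<open>m\<close>, and splits \<open>n - i\<close> off the support,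
  which is the extra point that \<open>shadowed_sum\<close> requires at
  \<open>n - i\<close>.\<close>

lemma sum_shadowed_partitions_h_sum_support:
  "(\<Sum>S\<in>shadowed_partitions r n.
      sp_power q r A S * h_sum q t (sp_support r S) (int (Suc m) - int (sp_size r S)))
    = (\<Sum>i\<in>{i\<in>{1..r}. i \<le> n}. A i ^ (q ^ (n - i)) * shadowed_sum q r A t (n - i) m)"
proof (cases "n = 0")
  case True
  hence "{i\<in>{1..r}. i \<le> n} = {}" by auto
  \<comment> \<open>The empty tuple contributes h over the empty set in degree \<open>Suc m\<close>,
    which is 0 because the degree is positive; the right-hand side is an empty sum.\<close>
  thus ?thesis using True
    by (simp add: shadowed_partitions_0 sp_size_def sp_support_def h_sum_empty
        del: Collect_empty_eq)
next
  case False
  hence n: "n > 0" by simp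
  let ?f = "\<lambda>S. sp_power q r A S * h_sum q t (sp_support r S) (int (Suc m) - int (sp_size r S))"
  let ?g = "\<lambda>i S. sp_power q r A S * h_sum q t (sp_support r S \<union> {n - i}) (int m - int (sp_size r S))"
  have "sum ?f (shadowed_partitions r n)
      = (\<Sum>(i, S)\<in>(SIGMA i:{i\<in>{1..r}. i \<le> n}. shadowed_partitions r (n - i)).
           ?f (S(i := insert (n - i) (S i))))"
    by (subst sum.reindex_bij_betw[OF bij_betw_shadowed_partitions[OF n, of r], symmetric])
      (simp add: case_prod_unfold)
  also have "\<dots> = (\<Sum>i\<in>{i\<in>{1..r}. i \<le> n}. \<Sum>S\<in>shadowed_partitions r (n - i).
           ?f (S(i := insert (n - i) (S i))))"
    by (simp add: sum.Sigma finite_shadowed_partitions)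
  also have "\<dots> = (\<Sum>i\<in>{i\<in>{1..r}. i \<le> n}. A i ^ (q ^ (n - i)) * shadowed_sum q r A t (n - i) m)"
  proof (intro sum.cong refl)
    fix i assume "i \<in> {i\<in>{1..r}. i \<le> n}"
    hence i: "i \<in> {1..r}" by auto
    have "?f (S(i := insert (n - i) (S i))) = A i ^ (q ^ (n - i)) * ?g i S"
      if S: "S \<in> shadowed_partitions r (n - i)" for S
    proof -
      have "n - i \<notin> S i" using sp_support_subset[OF S] i unfolding sp_support_def by blast
      note ins = sp_insert[OF S i this]
      show ?thesis by (simp add: ins)
    qed
    thus "(\<Sum>S\<in>shadowed_partitions r (n - i). ?f (S(i := insert (n - i) (S i))))
        = A i ^ (q ^ (n - i)) * shadowed_sum q r A t (n - i) m"
      by (simp add: shadowed_sum_def sum_distrib_left)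
  qed
  finally show ?thesis .
qed

lemma shadowed_sum_Suc:
  "shadowed_sum q r A t n (Suc m) = t ^ (q ^ n) * shadowed_sum q r A t n m
     + (\<Sum>i\<in>{i\<in>{1..r}. i \<le> n}. A i ^ (q ^ (n - i)) * shadowed_sum q r A t (n - i) m)"
proof -
  have "sp_power q r A S * h_sum q t (sp_support r S \<union> {n}) (int (Suc m) - int (sp_size r S))
      = t ^ (q ^ n) * (sp_power q r A S * h_sum q t (sp_support r S \<union> {n}) (int m - int (sp_size r S)))
        + sp_power q r A S * h_sum q t (sp_support r S) (int (Suc m) - int (sp_size r S))"
    if S: "S \<in> shadowed_partitions r n" for S
  proof -
    \<comment> \<open>The support lies below \<open>n\<close>, so the exponent at \<open>n\<close>
      can be split off.\<close>
    have "n \<notin> sp_support r S" using sp_support_subset[OF S] by auto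
    hence "h_sum q t (insert n (sp_support r S)) (int (Suc m) - int (sp_size r S))
      = h_sum q t (sp_support r S) (int (Suc m) - int (sp_size r S))
        + t ^ (q ^ n) * h_sum q t (insert n (sp_support r S)) (int (Suc m) - int (sp_size r S) - 1)"
      by (intro h_sum_insert finite_sp_support[OF S])
    moreover have "int (Suc m) - int (sp_size r S) - 1 = int m - int (sp_size r S)" by simp
    ultimately show ?thesis by (simp only: Un_insert_right Un_empty_right) (simp add: algebra_simps)
  qed
  hence "shadowed_sum q r A t n (Suc m) = (\<Sum>S\<in>shadowed_partitions r n.
      t ^ (q ^ n) * (sp_power q r A S * h_sum q t (sp_support r S \<union> {n}) (int m - int (sp_size r S)))
      + sp_power q r A S * h_sum q t (sp_support r S) (int (Suc m) - int (sp_size r S)))"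
    unfolding shadowed_sum_def by (intro sum.cong) auto
  thus ?thesis
    unfolding sum.distrib sum_shadowed_partitions_h_sum_support
    by (simp add: shadowed_sum_def sum_distrib_left)
qed

section \<open>Recursion for the coefficients of the Drinfeld module\<close>

text \<open>The default value 0 beyond \<open>r * m\<close> agrees with the true coefficient, since
  the expansion of \<open>\<phi> ([:0, 1:] ^ m)\<close> stops at \<open>r * m\<close>.\<close>

lemma drinfeld_coeff_eq_coeff:
  assumes "drinfeld_module \<iota> r A \<phi>"
  shows "drinfeld_coeff r \<phi> (int n) m = coeff (\<phi> ([:0, 1:] ^ m)) n"
proof -
  have "coeff (\<phi> ([:0, 1:] ^ m)) n
      = (\<Sum>k=0..r * m. if k = n then drinfeld_coeff r \<phi> (int n) m else 0)"
    unfolding drinfeld_coeff_expansion[OF assms, of m] coeff_sum by (intro sum.cong) auto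
  also have "\<dots> = drinfeld_coeff r \<phi> (int n) m"
    by (auto simp: drinfeld_coeff_def simp flip: of_nat_mult)
  finally show ?thesis ..
qed

lemma drinfeld_module_T_coeff:
  assumes "drinfeld_module \<iota> r A \<phi>"
  shows "coeff (\<phi> [:0, 1:]) i = (if i = 0 then \<iota> [:0, 1:] else if i \<le> r then A i else 0)"
proof -
  have "\<phi> [:0, 1:] = monom (\<iota> [:0, 1:]) 0 + (\<Sum>i=1..r. monom (A i) i)"
    using assms by (simp add: drinfeld_module_def)
  moreover have "coeff (\<Sum>k=1..r. monom (A k) k) i = (\<Sum>k=1..r. if k = i then A i else 0)"
    unfolding coeff_sum by (intro sum.cong) auto
  ultimately show ?thesis by auto
qed

lemma drinfeld_coeff_Suc:
  fixes \<phi> :: "'k::finite_field poly \<Rightarrow> 'l::field poly"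
  assumes \<phi>: "drinfeld_module \<iota> r A \<phi>"
  shows "coeff (\<phi> ([:0, 1:] ^ Suc m)) n
     = \<iota> [:0, 1:] ^ (CARD('k) ^ n) * coeff (\<phi> ([:0, 1:] ^ m)) n
       + (\<Sum>i\<in>{i\<in>{1..r}. i \<le> n}. A i ^ (CARD('k) ^ (n - i)) * coeff (\<phi> ([:0, 1:] ^ m)) (n - i))"
proof -
  let ?c = "coeff (\<phi> ([:0, 1:] ^ m))" and ?t = "coeff (\<phi> [:0, 1:])"
  have q: "CARD('k) > 0" by simp
  have mult: "\<phi> (a * b) = twisted_mult CARD('k) (\<phi> a) (\<phi> b)" for a b
    using \<phi>
    by (auto simp: drinfeld_module_def ring_hom_def ring_of_type_algebra_def twisted_poly_ring_def)
  \<comment> \<open>The factor T is put on the right: the Frobenius powers then fall on the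
    coefficients of \<open>\<phi> [:0, 1:]\<close> and leave those of
    \<open>\<phi> ([:0, 1:] ^ m)\<close> untouched.\<close>
  have "coeff (\<phi> ([:0, 1:] ^ Suc m)) n
      = (\<Sum>i\<le>n. ?c i * ?t (n - i) ^ (CARD('k) ^ i))"
    by (simp only: power_Suc2 mult twisted_mult_coeff[OF q])
  \<comment> \<open>Reflected so that \<open>i\<close> becomes the index of
    \<open>A i\<close>.\<close>
  also have "\<dots> = (\<Sum>i\<le>n. ?t i ^ (CARD('k) ^ (n - i)) * ?c (n - i))"
    by (rule sum.reindex_bij_witness[where i = "\<lambda>i. n - i" and j = "\<lambda>i. n - i"]) auto
  also have "\<dots> = ?t 0 ^ (CARD('k) ^ n) * ?c n
      + (\<Sum>i\<in>{..n} - {0}. ?t i ^ (CARD('k) ^ (n - i)) * ?c (n - i))"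
    by (subst sum.remove[of _ 0]) auto
  also have "(\<Sum>i\<in>{..n} - {0}. ?t i ^ (CARD('k) ^ (n - i)) * ?c (n - i))
      = (\<Sum>i\<in>{i\<in>{1..r}. i \<le> n}. A i ^ (CARD('k) ^ (n - i)) * ?c (n - i))"
    \<comment> \<open>Terms with \<open>i > r\<close> vanish, a power of zero with positive exponent
      being zero.\<close>
    by (rule sum.mono_neutral_cong_right)
      (auto simp: drinfeld_module_T_coeff[OF \<phi>] power_0_left)
  finally show ?thesis by (simp add: drinfeld_module_T_coeff[OF \<phi>])
qed

theorem theorem8p1:
  fixes \<iota> :: "'k::finite_field poly \<Rightarrow> 'l::field"
    and \<phi> :: "'k poly \<Rightarrow> 'l poly"
    and A :: "nat \<Rightarrow> 'l"
    and q r m n :: nat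
  assumes "q = CARD('k)"
    and "A_field \<iota>"
    and "drinfeld_module \<iota> r A \<phi>"
  shows "drinfeld_coeff r \<phi> (int n) m =
    (\<Sum>S\<in>shadowed_partitions r n.
       sp_power q r A S *
       h_sum q (\<iota> [:0, 1:]) (sp_support r S \<union> {n}) (int m - int (sp_size r S)))"
proof -
  have "\<phi> 1 = 1"
    using assms(3)
    by (auto simp: drinfeld_module_def ring_hom_def ring_of_type_algebra_def twisted_poly_ring_def)
  hence "coeff (\<phi> ([:0, 1:] ^ m)) n = shadowed_sum q r A (\<iota> [:0, 1:]) n m"
  \<comment> \<open>\<open>n\<close> is arbitrary because both recursions refer to the values at
    \<open>n - i\<close>.\<close>
  proof (induction m arbitrary: n)
    case 0
    thus ?case by (simp add: shadowed_sum_0)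
  next
    case (Suc m)
    show ?case
      unfolding drinfeld_coeff_Suc[OF assms(3)] shadowed_sum_Suc Suc.IH[OF Suc.prems] assms(1) ..
  qed
  thus ?thesis by (simp add: drinfeld_coeff_eq_coeff[OF assms(3)] shadowed_sum_def)
qed

end
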